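(* Let $r\ge 3$ be an integer. Then $m(K(2r+1,r))=2$. Moreover, for every pair of non-adjacent vertices $x,y$ of $K(2r+1,r)$, the set $\{x,y\}$ is a monophonic set of $K(2r+1,r)$.
   Context: The Kneser graph $K(2r+1,r)$ has as vertices all $r$-element subsets of $[2r+1]$, two vertices being adjacent iff they are disjoint. For a graph $G$ and $u,v\in V(G)$, the monophonic interval $J_G(u,v)$ is the set of all vertices lying on some induced $u,v$-path in $G$ (in particular $u,v\in J_G(u,v)$). A set $S\subseteq V(G)$ is a monophonic set of $G$ if for every $w\in V(G)$ there exist $x,y\in S$ with $w\in J_G(x,y)$. The monophonic number $m(G)$ is the minimum cardinality of a monophonic set of $G$. *)

theory Defs
  imports "Graph_Theory.Graph_Theory"
begin

text \<open>
  Undirected graphs are symmetric digraphs, as in the locale \<^locale>\<open>graph\<close>: an edge is a pair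
  of opposite arcs.
\<close>

definition kneser_graph :: "nat \<Rightarrow> nat \<Rightarrow> nat set pair_pre_digraph" where
  "kneser_graph n k =
     \<lparr> pverts = {A. A \<subseteq> {1..n} \<and> card A = k},
       parcs = {(A, B). A \<subseteq> {1..n} \<and> card A = k \<and> B \<subseteq> {1..n} \<and> card B = k \<and> A \<inter> B = {}} \<rparr>"

text \<open>For \<open>k = 0\<close> the only vertex, the empty set, is disjoint from itself and carries a loop.\<close>

lemma pair_graph_kneser_graph:
  assumes "0 < k"
  shows "pair_graph (kneser_graph n k)"
proof
  have fin: "finite (pverts (kneser_graph n k))"
    by (simp add: kneser_graph_def)
  show "finite (pverts (kneser_graph n k))" by (fact fin)
  have "parcs (kneser_graph n k) \<subseteq> pverts (kneser_graph n k) \<times> pverts (kneser_graph n k)"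
    by (auto simp: kneser_graph_def)
  with fin show "finite (parcs (kneser_graph n k))"
    by (intro finite_subset[OF _ finite_SigmaI])
  show "symmetric (with_proj (kneser_graph n k))"
    by (simp add: symmetric_def kneser_graph_def sym_def Int_commute)
  show "fst e \<in> pverts (kneser_graph n k)" if "e \<in> parcs (kneser_graph n k)" for e
    using that by (cases e) (simp add: kneser_graph_def)
  show "snd e \<in> pverts (kneser_graph n k)" if "e \<in> parcs (kneser_graph n k)" for e
    using that by (cases e) (simp add: kneser_graph_def)
  show "fst e \<noteq> snd e" if "e \<in> parcs (kneser_graph n k)" for e
  proof
    assume "fst e = snd e"
    with that have "card (fst e) = k" "fst e = {}"
      by (cases e; simp add: kneser_graph_def)+
    with assms show False by simp
  qed
qed

text \<open>
  The subgraph induced on the vertices of the path has no edges besides those of the path itself;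
  the converse relation accounts for the reverse arcs. The path may consist of a single vertex.
\<close>

definition induced_path :: "('a, 'b) pre_digraph \<Rightarrow> 'a \<Rightarrow> 'a vwalk \<Rightarrow> 'a \<Rightarrow> bool" where
  "induced_path G u p v \<longleftrightarrow>
     vpath p G \<and> hd p = u \<and> last p = v \<and>
     arcs_ends (G \<restriction> set p) = set (vwalk_arcs p) \<union> (set (vwalk_arcs p))\<inverse>"

definition monophonic_interval :: "('a, 'b) pre_digraph \<Rightarrow> 'a \<Rightarrow> 'a \<Rightarrow> 'a set" where
  "monophonic_interval G u v = {w. \<exists>p. induced_path G u p v \<and> w \<in> set p}"

definition monophonic_set :: "('a, 'b) pre_digraph \<Rightarrow> 'a set \<Rightarrow> bool" where
  "monophonic_set G S \<longleftrightarrow>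
     S \<subseteq> verts G \<and> (\<forall>w \<in> verts G. \<exists>x \<in> S. \<exists>y \<in> S. w \<in> monophonic_interval G x y)"

text \<open>Finiteness of \<open>S\<close> is automatic in a finite graph; in an infinite one it excludes the
  infinite sets, whose \<^const>\<open>card\<close> is 0.\<close>

definition monophonic_number :: "('a, 'b) pre_digraph \<Rightarrow> nat" where
  "monophonic_number G = (LEAST n. \<exists>S. finite S \<and> monophonic_set G S \<and> card S = n)"

lemma (in graph) monophonic_set_verts: "monophonic_set G (verts G)"
proof -
  have "induced_path G w [w] w" if "w \<in> verts G" for w
  proof -
    have "arcs_ends (G \<restriction> {w}) = {}"
      using no_loops unfolding arcs_ends_conv by fastforce
    with that show ?thesis
      by (simp add: induced_path_def vpath_def vwalk_def)
  qed
  then have "w \<in> monophonic_interval G w w" if "w \<in> verts G" for w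
    using that by (auto simp: monophonic_interval_def intro!: exI[of _ "[w]"])
  then show ?thesis
    by (auto simp: monophonic_set_def)
qed

lemma (in graph) monophonic_number_attained:
  "\<exists>S. monophonic_set G S \<and> card S = monophonic_number G"
proof -
  have "\<exists>n S. finite S \<and> monophonic_set G S \<and> card S = n"
    using finite_verts monophonic_set_verts by blast
  from LeastI_ex[OF this] show ?thesis
    unfolding monophonic_number_def by blast
qed

end

theory Submission
  imports Defs
begin

text \<open>
  For disjoint \<open>C\<close> and \<open>D\<close> of size at most \<open>r\<close>, the vertices that contain one of the two sets and
  avoid the other form a connected set, the cell of \<open>(C, D)\<close>, which is two consecutive layers of a
  cube.  If each of \<open>C\<close>, \<open>D\<close> meets each of \<open>C'\<close>, \<open>D'\<close>, then the cells of \<open>(C, D)\<close> and \<open>(C', D')\<close>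
  are disjoint and no edge joins them.  So let \<open>x\<close> have a neighbour in the first cell only, \<open>y\<close> in
  the second only, and \<open>w\<close> in both.  An induced path from \<open>x\<close> to \<open>w\<close> through the first cell followed
  by one from \<open>w\<close> to \<open>y\<close> through the second is then induced.  The sets \<open>C, D, C', D'\<close> are chosen
  according to how \<open>w\<close> meets the four regions \<open>x \<inter> y\<close>, \<open>x - y\<close>, \<open>y - x\<close> and \<open>- (x \<union> y)\<close>.
\<close>

section \<open>Induced paths\<close>

text \<open>Induced paths in a recursive form that grows at the head. Chords are tested only from a
  vertex towards later ones, which amounts to inducedness once \<open>E\<close> is symmetric and
  irreflexive.\<close>

fun chordless :: "('a \<Rightarrow> 'a \<Rightarrow> bool) \<Rightarrow> 'a list \<Rightarrow> bool" where
  "chordless E [] \<longleftrightarrow> True"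
| "chordless E [v] \<longleftrightarrow> True"
| "chordless E (u # v # p) \<longleftrightarrow>
     E u v \<and> u \<noteq> v \<and> (\<forall>z\<in>set p. z \<noteq> u \<and> \<not> E u z) \<and> chordless E (v # p)"

lemma chordless_distinct: "chordless E p \<Longrightarrow> distinct p"
  by (induction E p rule: chordless.induct) auto

lemma chordless_tl: "chordless E (u # p) \<Longrightarrow> chordless E p"
  by (cases p) auto

lemma chordless_suffix: "chordless E (p @ q) \<Longrightarrow> chordless E q"
  by (induction p) (auto dest: chordless_tl)

lemma chordless_Cons:
  "chordless E (u # v # p)" if "chordless E (v # p)" "E u v" "u \<notin> set (v # p)" "\<forall>z\<in>set p. \<not> E u z"
  using that by auto

text \<open>Chords at \<open>w\<close> are excluded by the two halves, so only pairs with one vertex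
  strictly before \<open>w\<close> and one strictly after it remain to be checked.\<close>

lemma chordless_append:
  assumes "chordless E (p @ [w])" "chordless E (w # q)"
    and "\<And>a b. a \<in> set p \<Longrightarrow> b \<in> set q \<Longrightarrow> a \<noteq> b \<and> \<not> E a b"
  shows "chordless E (p @ w # q)"
  using assms
proof (induction p)
  case (Cons u p)
  have "chordless E (p @ w # q)"
    by (rule Cons.IH[OF chordless_tl Cons.prems(2)]) (use Cons.prems(1,3) in simp_all)
  moreover have "\<forall>b\<in>set q. b \<noteq> u \<and> \<not> E u b"
    using Cons.prems(3)[of u] by auto
  ultimately show ?case
    using Cons.prems(1) by (cases p) (simp_all add: ball_Un)
qed simp

section \<open>Chordless paths extracted from walks\<close>

abbreviation walk_in :: "('a \<Rightarrow> 'a \<Rightarrow> bool) \<Rightarrow> 'a set \<Rightarrow> 'a \<Rightarrow> 'a \<Rightarrow> bool" where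
  "walk_in E S \<equiv> (\<lambda>a b. E a b \<and> a \<in> S \<and> b \<in> S)\<^sup>*\<^sup>*"

lemma walk_in_mono: "walk_in E S u v \<Longrightarrow> S \<subseteq> T \<Longrightarrow> walk_in E T u v"
  by (erule rtranclp_mono[THEN predicate2D, rotated]) auto

lemma walk_in_sym: "walk_in E S u v \<Longrightarrow> symp E \<Longrightarrow> walk_in E S v u"
  by (rule sympD[OF symp_rtranclp]) (auto simp: symp_def)

text \<open>The path is built backwards from \<open>v\<close>, with shortcuts that remove chords.
  The hypothesis \<open>v \<in> S\<close> covers the empty walk, since the reflexive closure relates
  even vertices outside \<open>S\<close> to themselves.\<close>

lemma walk_in_chordless:
  assumes "walk_in E S u v" "v \<in> S"
  shows "\<exists>p. chordless E p \<and> p \<noteq> [] \<and> hd p = u \<and> last p = v \<and> set p \<subseteq> S"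
  using assms(1)
proof (induction rule: converse_rtranclp_induct)
  case base
  with assms(2) show ?case by (intro exI[of _ "[v]"]) auto
next
  case (step u u')
  then obtain p where p: "chordless E p" "p \<noteq> []" "hd p = u'" "last p = v" "set p \<subseteq> S"
    by blast
  show ?case
  proof (cases "u \<in> set p")
    case True
    then obtain ys zs where "p = ys @ u # zs" by (meson split_list)
    with p show ?thesis
      by (intro exI[of _ "u # zs"]) (auto dest: chordless_suffix)
  next
    case False
    have "\<exists>z\<in>set p. E u z"
      using p step.hyps by (metis hd_in_set)
    \<comment> \<open>Jumping from \<open>u\<close> to its last neighbour on \<open>p\<close> leaves
      no later neighbour that could give a chord.\<close>
    then obtain ys z zs where z: "p = ys @ z # zs" "E u z" "\<forall>z'\<in>set zs. \<not> E u z'"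
      by (metis split_list_last_prop)
    then have "chordless E (u # z # zs)"
      using p(1) False by (intro chordless_Cons) (auto dest: chordless_suffix)
    with p z step.hyps show ?thesis
      by (intro exI[of _ "u # z # zs"]) auto
  qed
qed

lemma chordless_through:
  assumes "walk_in E X x a" "x \<in> X" "a \<in> X" "E a w" "w \<notin> X"
    and "walk_in E Y b y" "b \<in> Y" "y \<in> Y" "E w b" "w \<notin> Y"
    and apart: "\<And>u v. u \<in> X \<Longrightarrow> v \<in> Y \<Longrightarrow> u \<noteq> v \<and> \<not> E u v"
  shows "\<exists>p. chordless E p \<and> p \<noteq> [] \<and> hd p = x \<and> last p = y \<and> w \<in> set p \<and> set p \<subseteq> insert w (X \<union> Y)"
proof -
  have "walk_in E (insert w X) x w"
    by (rule rtranclp.rtrancl_into_rtrancl[OF walk_in_mono[OF assms(1)]]) (use assms(3,4) in auto)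
  from walk_in_chordless[OF this] obtain p where
    p: "chordless E p" "p \<noteq> []" "hd p = x" "last p = w" "set p \<subseteq> insert w X" by auto
  \<comment> \<open>By distinctness \<open>w\<close> occurs only at the end of \<open>p\<close>, so
    the rest stays in \<open>X\<close>. It is nonempty because \<open>x \<noteq> w\<close>, hence
    the joined path still starts at \<open>x\<close>.\<close>
  define p' where "p' = butlast p"
  have p': "p = p' @ [w]"
    using p by (metis append_butlast_last_id p'_def)
  with chordless_distinct[OF p(1)] p(5) have sub: "set p' \<subseteq> X" by auto
  have "p' \<noteq> []" using p p' assms by auto
  have "walk_in E (insert w Y) w y"
    by (rule converse_rtranclp_into_rtranclp[OF _ walk_in_mono[OF assms(6)]]) (use assms(7,9) in auto)
  from walk_in_chordless[OF this] \<open>y \<in> Y\<close> obtain q where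
    q: "chordless E q" "q \<noteq> []" "hd q = w" "last q = y" "set q \<subseteq> insert w Y" by auto
  then obtain q' where q': "q = w # q'" by (cases q) auto
  with chordless_distinct[OF q(1)] q(5) have "set q' \<subseteq> Y" by auto
  have "chordless E (p' @ w # q')"
  proof (rule chordless_append)
    show "chordless E (p' @ [w])" "chordless E (w # q')" using p(1) q(1) p' q' by simp_all
    show "a \<noteq> b \<and> \<not> E a b" if "a \<in> set p'" "b \<in> set q'" for a b
      using that sub \<open>set q' \<subseteq> Y\<close> by (intro apart) auto
  qed
  with p' q' p q sub \<open>set q' \<subseteq> Y\<close> \<open>p' \<noteq> []\<close> show ?thesis
    by (intro exI[of _ "p' @ w # q'"]) auto
qed

text \<open>Bridge to the arc condition of \<open>induced_path\<close>: prepending \<open>u\<close>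
  to a path starting at \<open>v\<close> adds just the two opposite arcs between \<open>u\<close>
  and \<open>v\<close>.\<close>

lemma chordless_induced_path:
  assumes "symp E" "irreflp E" "chordless E p"
  shows "{(a, b). a \<in> set p \<and> b \<in> set p \<and> E a b} = set (vwalk_arcs p) \<union> (set (vwalk_arcs p))\<inverse>"
  using assms(3)
proof (induction p rule: vwalk_arcs.induct)
  case (3 u v p)
  have "{(a, b). a \<in> set (u # v # p) \<and> b \<in> set (u # v # p) \<and> E a b} =
    {(u, v), (v, u)} \<union> {(a, b). a \<in> set (v # p) \<and> b \<in> set (v # p) \<and> E a b}"
    using 3(2) assms(1,2) by (auto dest: sympD irreflpD)
  also have "{(a, b). a \<in> set (v # p) \<and> b \<in> set (v # p) \<and> E a b} =
    set (vwalk_arcs (v # p)) \<union> (set (vwalk_arcs (v # p)))\<inverse>"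
    using 3 by (auto dest: chordless_tl)
  finally show ?case by auto
qed (use assms(2) in \<open>auto dest: irreflpD\<close>)

lemma (in pair_graph) chordless_monophonic_interval:
  assumes "chordless (\<lambda>a b. (a, b) \<in> parcs G) p" "p \<noteq> []" "set p \<subseteq> pverts G" "w \<in> set p"
  shows "w \<in> monophonic_interval (with_proj G) (hd p) (last p)"
proof -
  let ?E = "\<lambda>a b. (a, b) \<in> parcs G"
  have "symp ?E"
    using arcs_symmetric by (auto simp: symp_def)
  moreover have "irreflp ?E"
    using no_loops by (fastforce simp: irreflp_def)
  ultimately have *: "{(a, b). a \<in> set p \<and> b \<in> set p \<and> ?E a b} =
      set (vwalk_arcs p) \<union> (set (vwalk_arcs p))\<inverse>"
    using assms(1) by (rule chordless_induced_path)
  have "arcs_ends (with_proj G \<restriction> set p) = {(a, b). a \<in> set p \<and> b \<in> set p \<and> ?E a b}"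
    by (auto simp: arcs_ends_conv image_iff)
  moreover have "set (vwalk_arcs p) \<subseteq> {(a, b). a \<in> set p \<and> b \<in> set p \<and> ?E a b}"
    unfolding * by (rule Un_upper1)
  then have "set (vwalk_arcs p) \<subseteq> parcs G"
    by blast
  then have "vpath p (with_proj G)"
    using assms chordless_distinct[OF assms(1)]
    by (simp add: vpath_def vwalk_def arcs_ends_conv)
  ultimately have "induced_path (with_proj G) (hd p) p (last p)"
    by (simp add: induced_path_def *)
  with assms(4) show ?thesis
    by (auto simp: monophonic_interval_def)
qed

section \<open>Cells of the odd graph\<close>

locale odd_graph =
  fixes r :: nat
  assumes r_ge: "r \<ge> 3"
begin

definition N :: "nat set" where
  "N = {1..2 * r + 1}"

definition V :: "nat set set" where
  "V = {A. A \<subseteq> N \<and> card A = r}"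

definition adj :: "nat set \<Rightarrow> nat set \<Rightarrow> bool" where
  "adj A B \<longleftrightarrow> A \<in> V \<and> B \<in> V \<and> A \<inter> B = {}"

definition cell :: "nat set \<Rightarrow> nat set \<Rightarrow> nat set set" where
  "cell C D = {A \<in> V. C \<subseteq> A \<and> D \<inter> A = {} \<or> D \<subseteq> A \<and> C \<inter> A = {}}"

text \<open>The vertices with this property turn out to be those with a neighbour in the cell.\<close>

definition link :: "nat set \<Rightarrow> nat set \<Rightarrow> nat set \<Rightarrow> bool" where
  "link C D z \<longleftrightarrow>
     z \<inter> C = {} \<and> (\<exists>e. D \<subseteq> insert e z) \<or> z \<inter> D = {} \<and> (\<exists>e. C \<subseteq> insert e z)"

text \<open>Working form of "\<open>w\<close> lies in the monophonic interval of \<open>x\<close>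
  and \<open>y\<close>", free of the digraph encoding.\<close>

definition threaded :: "nat set \<Rightarrow> nat set \<Rightarrow> nat set \<Rightarrow> bool" where
  "threaded x w y \<longleftrightarrow>
     (\<exists>p. chordless adj p \<and> p \<noteq> [] \<and> hd p = x \<and> last p = y \<and> w \<in> set p \<and> set p \<subseteq> V)"

lemma finite_N [simp]: "finite N" and card_N: "card N = 2 * r + 1"
  by (simp_all add: N_def)

lemma V_D: "A \<in> V \<Longrightarrow> A \<subseteq> N" "A \<in> V \<Longrightarrow> card A = r" "A \<in> V \<Longrightarrow> finite A"
  by (auto simp: V_def intro: finite_subset[OF _ finite_N])

lemma card_compl: "A \<in> V \<Longrightarrow> card (N - A) = r + 1"
  by (simp add: card_Diff_subset card_N V_D)

lemma V_eqI: "A \<in> V \<Longrightarrow> B \<in> V \<Longrightarrow> A \<subseteq> B \<Longrightarrow> A = B"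
  by (simp add: V_D card_subset_eq)

lemma symp_adj: "symp adj"
  by (auto simp: symp_def adj_def)

lemma adj_compl: "A \<in> V \<Longrightarrow> e \<in> N - A \<Longrightarrow> adj A (N - A - {e})"
  using card_compl[of A] by (auto simp: adj_def V_def)

section \<open>Neighbours of a cell and its connectedness\<close>

lemma cell_commute: "cell D C = cell C D"
  by (auto simp: cell_def)

lemma cell_subset: "cell C D \<subseteq> V"
  by (auto simp: cell_def)

text \<open>Adjacent vertices cover \<open>2 * r\<close> of the \<open>2 * r + 1\<close> points. So
  a set avoiding \<open>A\<close> lies in \<open>z\<close> up to the single point \<open>e\<close>
  that both miss.\<close>

lemma link_if_adj_cell:
  assumes "adj z A" "A \<in> cell C D" "C \<subseteq> N" "D \<subseteq> N"
  shows "link C D z"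
proof -
  have "card (N - A - z) = card (N - A) - card z"
    using assms(1) by (intro card_Diff_subset) (auto simp: adj_def V_D dest: V_D(1))
  then have "card (N - A - z) = 1"
    using assms(1) by (simp add: adj_def card_compl V_D)
  then obtain e where "N - A - z = {e}"
    by (auto simp: card_1_singleton_iff)
  then have "N \<subseteq> A \<union> insert e z" by blast
  then have *: "B \<subseteq> insert e z" if "B \<subseteq> N" "B \<inter> A = {}" for B
    using that by blast
  from assms(1,2) have "C \<inter> z = {} \<and> D \<inter> A = {} \<or> D \<inter> z = {} \<and> C \<inter> A = {}"
    by (auto simp: cell_def adj_def)
  then show ?thesis
    using *[OF assms(3)] *[OF assms(4)] unfolding link_def by blast
qed

text \<open>The neighbour is the complement of \<open>z\<close> without one point \<open>e'\<close>,
  which must lie outside \<open>C\<close> and be the only point of \<open>D\<close> that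
  \<open>z\<close> may miss. If \<open>D \<subseteq> z\<close>, a suitable \<open>e'\<close> exists
  because the complement of \<open>z\<close> has \<open>r + 1\<close> points and \<open>C\<close> at
  most \<open>r\<close>; otherwise \<open>e\<close> itself lies in \<open>D - z\<close> and
  serves.\<close>

lemma adj_layer_if_link:
  assumes "z \<in> V" "z \<inter> C = {}" "D \<subseteq> insert e z" "C \<inter> D = {}" "C \<subseteq> N" "D \<subseteq> N" "card C \<le> r"
  shows "\<exists>A\<in>cell C D. adj z A"
proof -
  have "\<exists>e'. e' \<in> N - z - C \<and> D \<subseteq> insert e' z"
  proof (cases "D \<subseteq> z")
    case True
    have "finite C"
      using assms(5) by (rule finite_subset) simp
    then have "\<not> N - z \<subseteq> C"
      using assms(1,7) card_compl[of z] card_mono[of C "N - z"] by auto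
    with True show ?thesis by auto
  next
    case False
    with assms show ?thesis by (intro exI[of _ e]) auto
  qed
  then obtain e' where e': "e' \<in> N - z - C" "D \<subseteq> insert e' z" by blast
  then have "adj z (N - z - {e'})"
    using assms(1) by (intro adj_compl) auto
  moreover from this e' assms have "N - z - {e'} \<in> cell C D"
    by (auto simp: cell_def adj_def)
  ultimately show ?thesis by blast
qed

lemma adj_cell_if_link:
  assumes "link C D z" "z \<in> V" "C \<inter> D = {}" "C \<subseteq> N" "D \<subseteq> N" "card C \<le> r" "card D \<le> r"
  shows "\<exists>A\<in>cell C D. adj z A"
  using assms(1) unfolding link_def
proof (elim disjE conjE exE)
  fix e assume "z \<inter> C = {}" "D \<subseteq> insert e z"
  with assms show ?thesis by (intro adj_layer_if_link) auto
next
  fix e assume "z \<inter> D = {}" "C \<subseteq> insert e z"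
  with assms have "\<exists>A\<in>cell D C. adj z A" by (intro adj_layer_if_link) auto
  then show ?thesis by (simp only: cell_commute)
qed

text \<open>Exchange argument: \<open>A\<close> approaches \<open>B\<close> by trading one point
  \<open>a\<close> for one point \<open>b\<close>. Each trade takes two edges, through a vertex
  \<open>M\<close> of the opposite layer.\<close>

lemma walk_in_layer:
  assumes "A \<in> V" "B \<in> V" "C \<subseteq> A" "D \<inter> A = {}" "C \<subseteq> B" "D \<inter> B = {}" "D \<subseteq> N"
  shows "walk_in adj (cell C D) A B"
  using assms(1,3,4)
proof (induction "card (A - B)" arbitrary: A)
  case 0
  then have "A \<subseteq> B" by (simp add: V_D)
  then show ?case using V_eqI[of A B] 0 assms by simp
next
  case (Suc k)
  then have "A - B \<noteq> {}" by force
  then obtain a where a: "a \<in> A" "a \<notin> B" by blast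
  have "\<not> B \<subseteq> A" using V_eqI[of B A] a Suc.prems assms(2) by auto
  then obtain b where b: "b \<in> B" "b \<notin> A" by blast
  have "b \<in> N" using b assms(2) by (auto dest: V_D)
  \<comment> \<open>\<open>M\<close> is the common neighbour of \<open>A\<close> and of
    \<open>A\<close> with \<open>a\<close> replaced by \<open>b\<close>. It contains
    \<open>D\<close>, which avoids both \<open>A\<close> and \<open>b\<close>, and it avoids
    \<open>C \<subseteq> A\<close>.\<close>
  define M where "M = N - A - {b}"
  have AM: "adj A M"
    unfolding M_def using Suc.prems b \<open>b \<in> N\<close> by (intro adj_compl) auto
  have "N - M - {a} = insert b (A - {a})"
    using b \<open>b \<in> N\<close> V_D(1)[OF Suc.prems(1)] a by (auto simp: M_def)
  moreover have "adj M (N - M - {a})"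
    using AM a V_D(1)[OF Suc.prems(1)] by (intro adj_compl) (auto simp: adj_def M_def)
  ultimately have MA: "adj M (insert b (A - {a}))" by simp
  have "M \<in> cell C D"
    using AM assms b Suc.prems by (auto simp: cell_def adj_def M_def)
  moreover have "A \<in> cell C D"
    using Suc.prems by (auto simp: cell_def)
  moreover have A': "insert b (A - {a}) \<in> V" "C \<subseteq> insert b (A - {a})" "D \<inter> insert b (A - {a}) = {}"
    using MA assms a b Suc.prems by (auto simp: adj_def)
  moreover from A' have "insert b (A - {a}) \<in> cell C D"
    by (auto simp: cell_def)
  moreover have "walk_in adj (cell C D) (insert b (A - {a})) B"
  proof (rule Suc.hyps(1)[OF _ A'])
    have "insert b (A - {a}) - B = (A - B) - {a}"
      using a b by auto
    with a Suc.hyps(2) show "k = card (insert b (A - {a}) - B)"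
      by simp
  qed
  ultimately show ?case
    using AM MA
    by (intro converse_rtranclp_into_rtranclp[of _ A M]
        converse_rtranclp_into_rtranclp[of _ M "insert b (A - {a})"]) simp_all
qed

lemma walk_in_cell:
  assumes "A \<in> cell C D" "B \<in> cell C D"
    and "C \<inter> D = {}" "C \<subseteq> N" "D \<subseteq> N" "card C \<le> r" "card D \<le> r"
  shows "walk_in adj (cell C D) A B"
proof -
  \<comment> \<open>One edge leads from the layer containing \<open>D\<close> to the layer
    containing \<open>C\<close>: take the complement of \<open>A\<close> and drop a point outside
    \<open>C\<close>, which exists since \<open>r + 1 > card C\<close>.\<close>
  have to_layer: "\<exists>A'. walk_in adj (cell C D) A A' \<and> A' \<in> V \<and> C \<subseteq> A' \<and> D \<inter> A' = {}"
    if A: "A \<in> cell C D" for A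
  proof (cases "C \<subseteq> A \<and> D \<inter> A = {}")
    case True
    with A show ?thesis by (auto simp: cell_def)
  next
    case False
    with A have *: "A \<in> V" "D \<subseteq> A" "C \<inter> A = {}" by (auto simp: cell_def)
    have "\<not> N - A \<subseteq> C"
      using assms(4,6) card_compl[OF *(1)] card_mono[of C "N - A"] finite_subset[OF assms(4)] by auto
    then obtain e where e: "e \<in> N - A" "e \<notin> C" by blast
    then have "adj A (N - A - {e})" using * by (intro adj_compl) auto
    moreover from this * e assms have "N - A - {e} \<in> cell C D" "C \<subseteq> N - A - {e}" "D \<inter> (N - A - {e}) = {}"
      by (auto simp: cell_def adj_def)
    ultimately show ?thesis
      using A by (intro exI[of _ "N - A - {e}"]) (auto simp: adj_def)
  qed
  obtain A' where A': "walk_in adj (cell C D) A A'" "A' \<in> V" "C \<subseteq> A'" "D \<inter> A' = {}"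
    using to_layer[OF assms(1)] by blast
  obtain B' where B': "walk_in adj (cell C D) B B'" "B' \<in> V" "C \<subseteq> B'" "D \<inter> B' = {}"
    using to_layer[OF assms(2)] by blast
  have "walk_in adj (cell C D) A' B'"
    using A' B' assms by (intro walk_in_layer) auto
  with A'(1) walk_in_sym[OF B'(1) symp_adj] show ?thesis
    by (meson rtranclp_trans)
qed

text \<open>The block contained in \<open>A\<close> meets the block contained in \<open>B\<close>,
  so \<open>A\<close> and \<open>B\<close> are not disjoint. It also meets the block that
  \<open>B\<close> avoids, so they differ.\<close>

lemma cells_apart:
  assumes "C \<inter> C' \<noteq> {}" "C \<inter> D' \<noteq> {}" "D \<inter> C' \<noteq> {}" "D \<inter> D' \<noteq> {}"
    and "A \<in> cell C D" "B \<in> cell C' D'"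
  shows "A \<noteq> B \<and> \<not> adj A B"
proof -
  have key: "A \<noteq> B \<and> A \<inter> B \<noteq> {}"
    if "K \<subseteq> A" "K' \<subseteq> B" "L \<inter> B = {}" "K \<inter> K' \<noteq> {}" "K \<inter> L \<noteq> {}" for K K' L
    using that by blast
  have "C \<subseteq> A \<or> D \<subseteq> A" "C' \<subseteq> B \<and> D' \<inter> B = {} \<or> D' \<subseteq> B \<and> C' \<inter> B = {}"
    using assms(5,6) by (auto simp: cell_def)
  then have "A \<noteq> B \<and> A \<inter> B \<noteq> {}"
    using assms(1-4) by (elim disjE conjE) (rule key; assumption)+
  then show ?thesis by (simp add: adj_def)
qed

lemma threaded_if_links:
  assumes V: "x \<in> V" "y \<in> V" "w \<in> V" and xy: "x \<noteq> y" "\<not> adj x y"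
    and CD: "C \<inter> D = {}" "C \<subseteq> N" "D \<subseteq> N" "card C \<le> r" "card D \<le> r"
    and CD': "C' \<inter> D' = {}" "C' \<subseteq> N" "D' \<subseteq> N" "card C' \<le> r" "card D' \<le> r"
    and cross: "C \<inter> C' \<noteq> {}" "C \<inter> D' \<noteq> {}" "D \<inter> C' \<noteq> {}" "D \<inter> D' \<noteq> {}"
    and x: "link C D x" "\<not> link C' D' x"
    and y: "link C' D' y" "\<not> link C D y"
    and w: "link C D w" "link C' D' w"
  shows "threaded x w y"
proof -
  let ?X = "cell C D" and ?Y = "cell C' D'"
  \<comment> \<open>Members of a cell satisfy its \<open>link\<close>, so the negated links keep
    \<open>x\<close> out of \<open>?Y\<close> and \<open>y\<close> out of \<open>?X\<close>, besides
    excluding edges.\<close>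
  have link_X: "link C D A" if "A \<in> ?X" for A
    using that CD by (auto simp: cell_def link_def)
  have link_Y: "link C' D' A" if "A \<in> ?Y" for A
    using that CD' by (auto simp: cell_def link_def)
  obtain a where a: "a \<in> ?X" "adj x a" using adj_cell_if_link[OF x(1) V(1) CD] by blast
  obtain b where b: "b \<in> ?Y" "adj y b" using adj_cell_if_link[OF y(1) V(2) CD'] by blast
  obtain a' where a': "a' \<in> ?X" "adj w a'" using adj_cell_if_link[OF w(1) V(3) CD] by blast
  obtain b' where b': "b' \<in> ?Y" "adj w b'" using adj_cell_if_link[OF w(2) V(3) CD'] by blast
  have nadj: "\<not> adj x B" if "B \<in> ?Y" for B
    using link_if_adj_cell[OF _ that] CD' x(2) by blast
  have nadj': "\<not> adj A y" if "A \<in> ?X" for A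
    using link_if_adj_cell[OF _ that] CD y(2) symp_adj by (blast dest: sympD)
  have walk_X: "walk_in adj (insert x ?X) x a'"
  proof (rule converse_rtranclp_into_rtranclp)
    show "adj x a \<and> x \<in> insert x ?X \<and> a \<in> insert x ?X" using a by simp
    show "walk_in adj (insert x ?X) a a'"
      by (rule walk_in_mono[OF walk_in_cell[OF a(1) a'(1) CD]]) auto
  qed
  have walk_Y: "walk_in adj (insert y ?Y) b' y"
  proof (rule rtranclp.rtrancl_into_rtrancl)
    show "adj b y \<and> b \<in> insert y ?Y \<and> y \<in> insert y ?Y"
      using b symp_adj by (auto dest: sympD)
    show "walk_in adj (insert y ?Y) b' b"
      by (rule walk_in_mono[OF walk_in_cell[OF b'(1) b(1) CD']]) auto
  qed
  have apart: "u \<noteq> v \<and> \<not> adj u v" if "u \<in> insert x ?X" "v \<in> insert y ?Y" for u v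
    using that cells_apart[OF cross, of u v] nadj nadj' xy link_X link_Y x y by auto
  \<comment> \<open>\<open>w\<close> has a neighbour in each cell, while no edge joins the two
    sides; hence it lies on neither.\<close>
  have "w \<notin> insert x ?X" "w \<notin> insert y ?Y"
    using apart a' b' symp_adj by (blast dest: sympD)+
  then have "\<exists>p. chordless adj p \<and> p \<noteq> [] \<and> hd p = x \<and> last p = y \<and> w \<in> set p \<and>
      set p \<subseteq> insert w (insert x ?X \<union> insert y ?Y)"
    using a' b' sympD[OF symp_adj a'(2)]
    by (intro chordless_through[OF walk_X _ _ _ _ walk_Y _ _ _ _ apart]) simp_all
  then obtain p where p: "chordless adj p \<and> p \<noteq> [] \<and> hd p = x \<and> last p = y \<and> w \<in> set p \<and>
      set p \<subseteq> insert w (insert x ?X \<union> insert y ?Y)"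
    by (elim exE)
  have "insert w (insert x ?X \<union> insert y ?Y) \<subseteq> V"
    using V cell_subset by auto
  with p have "set p \<subseteq> V" by (meson subset_trans)
  with p show ?thesis
    unfolding threaded_def by (intro exI[of _ p] conjI) simp_all
qed

section \<open>Choosing the cells\<close>

text \<open>The first pair of blocks separates the four points by membership in \<open>x\<close>,
  the second by membership in \<open>y\<close>. As \<open>w\<close> holds exactly one of them, in
  each pair it avoids one block and misses one point of the other. But \<open>x\<close> meets both
  blocks of the second pair, and \<open>y\<close> both of the first.\<close>

lemma threaded_transversal:
  assumes V: "x \<in> V" "y \<in> V" "w \<in> V" and xy: "x \<noteq> y" "\<not> adj x y"
    and abcd: "a \<in> x \<inter> y" "b \<in> x - y" "c \<in> y - x" "d \<in> N - (x \<union> y)"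
    and "a \<in> w \<and> b \<notin> w \<and> c \<notin> w \<and> d \<notin> w \<or> a \<notin> w \<and> b \<in> w \<and> c \<notin> w \<and> d \<notin> w \<or>
      a \<notin> w \<and> b \<notin> w \<and> c \<in> w \<and> d \<notin> w \<or> a \<notin> w \<and> b \<notin> w \<and> c \<notin> w \<and> d \<in> w"
  shows "threaded x w y"
proof -
  have "{a, b, c, d} \<subseteq> N" using abcd V by (auto dest: V_D)
  from assms(10) have w: "link {a, b} {c, d} w \<and> link {a, c} {b, d} w"
    by (elim disjE conjE) (auto simp: link_def)
  show ?thesis
  proof (rule threaded_if_links[OF V xy, of "{a, b}" "{c, d}" "{a, c}" "{b, d}"])
    show "link {a, b} {c, d} w" "link {a, c} {b, d} w" using w by simp_all
  qed (use abcd r_ge \<open>{a, b, c, d} \<subseteq> N\<close> in \<open>auto simp: link_def card_insert_if\<close>)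
qed

text \<open>Here \<open>w\<close> contains every point on which \<open>x\<close> and
  \<open>y\<close> agree, so the points missing from \<open>w\<close> come from the symmetric
  difference. A third such point \<open>z\<close> exists because \<open>r + 1 > 2\<close>.\<close>

lemma threaded_equal_opposite:
  assumes V: "x \<in> V" "y \<in> V" "w \<in> V" and xy: "x \<noteq> y" "\<not> adj x y"
    and w: "x \<inter> y \<subseteq> w" "N - (x \<union> y) \<subseteq> w" "\<not> x \<subseteq> w" "\<not> y \<subseteq> w"
    and two: "card (N - (x \<union> y)) \<ge> 2"
  shows "threaded x w y"
proof -
  obtain d d' where d: "d \<in> N - (x \<union> y)" "d' \<in> N - (x \<union> y)" "d \<noteq> d'"
    using two card_le_Suc0_iff_eq[of "N - (x \<union> y)"] by force
  obtain p where p: "p \<in> x - y" "p \<notin> w" using w by blast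
  obtain q where q: "q \<in> y - x" "q \<notin> w" using w by blast
  have "\<not> N - w \<subseteq> {p, q}"
  proof
    assume "N - w \<subseteq> {p, q}"
    then have "card (N - w) \<le> card {p, q}" by (intro card_mono) auto
    also have "\<dots> \<le> 2" by (simp add: card_insert_if)
    finally show False using card_compl[OF V(3)] r_ge by simp
  qed
  then obtain z where z: "z \<in> N - w" "z \<noteq> p" "z \<noteq> q" by blast
  have N: "{d, d', p, q, z} \<subseteq> N" using d p q z V by (auto dest: V_D)
  show ?thesis
  proof (cases "z \<in> y")
    case True
    with z w have "z \<notin> x" by auto
    with True show ?thesis
      \<comment> \<open>\<open>x\<close> avoids \<open>{q, z}\<close> but misses both
        \<open>d\<close> and \<open>d'\<close> of the other block, so it is not linked to the second
        cell. The case \<open>z \<in> x\<close> is the mirror image under exchanging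
        \<open>x\<close> with \<open>y\<close> and \<open>p\<close> with \<open>q\<close>.\<close>
      by (intro threaded_if_links[OF V xy, of "{p, q}" "{d, z}" "{q, z}" "{d, d', p}"])
        (use d p q z w r_ge N in \<open>auto simp: link_def card_insert_if\<close>)
  next
    case False
    with z w have "z \<in> x" by auto
    with False show ?thesis
      by (intro threaded_if_links[OF V xy, of "{p, z}" "{d, d', q}" "{p, q}" "{d, z}"])
        (use d p q z w r_ge N in \<open>auto simp: link_def card_insert_if\<close>)
  qed
qed

text \<open>Here the points missing from \<open>w\<close> are points on which \<open>x\<close> and
  \<open>y\<close> agree: \<open>c\<close> from the intersection and at least two from outside
  \<open>x \<union> y\<close>.\<close>

lemma threaded_sym_diff:
  assumes V: "x \<in> V" "y \<in> V" "w \<in> V" and xy: "x \<noteq> y" "\<not> adj x y"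
    and w: "x - y \<subseteq> w" "y - x \<subseteq> w" "\<not> x \<subseteq> w"
    and card_out: "card (N - (x \<union> y)) = card (x \<inter> y) + 1"
  shows "threaded x w y"
proof -
  obtain c where c: "c \<in> x \<inter> y" "c \<notin> w" using w by blast
  obtain p where p: "p \<in> x - y" using V_eqI[OF V(1,2)] xy by blast
  obtain q where q: "q \<in> y - x" using V_eqI[OF V(2,1)] xy by blast
  \<comment> \<open>At most \<open>r - 1\<close> of the \<open>r + 1\<close> points missing from
    \<open>w\<close> lie in \<open>x \<inter> y\<close>, which leaves two outside
    \<open>x \<union> y\<close>.\<close>
  have "\<exists>u v. u \<in> N - (x \<union> y) - w \<and> v \<in> N - (x \<union> y) - w \<and> u \<noteq> v"
  proof (rule ccontr)
    assume "\<not> ?thesis"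
    then have "card (N - (x \<union> y) - w) \<le> 1"
      using card_le_Suc0_iff_eq[of "N - (x \<union> y) - w"] by auto
    moreover have "card (x \<inter> y) < card x"
      using p V by (intro psubset_card_mono) (auto simp: V_D)
    moreover have "card (N - w) \<le> card ((x \<inter> y) \<union> (N - (x \<union> y) - w))"
      using w V by (intro card_mono) (auto simp: V_D)
    moreover have "\<dots> \<le> card (x \<inter> y) + card (N - (x \<union> y) - w)"
      by (rule card_Un_le)
    ultimately show False using card_compl[OF V(3)] V_D(2)[OF V(1)] by simp
  qed
  then obtain u v where uv: "u \<in> N - (x \<union> y)" "u \<notin> w" "v \<in> N - (x \<union> y)" "v \<notin> w" "u \<noteq> v"
    by blast
  have N: "{c, p, q, u, v} \<subseteq> N" using c p q uv V by (auto dest: V_D)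
  show ?thesis
  proof (cases "\<exists>e. e \<in> N - y \<and> e \<in> w \<and> e \<noteq> p")
    case True
    then obtain e where e: "e \<in> N - y" "e \<in> w" "e \<noteq> p" by blast
    \<comment> \<open>The point \<open>e\<close> spoils the link of \<open>y\<close> to the first
      cell: \<open>y\<close> misses both \<open>p\<close> and \<open>e\<close>, and it contains
      \<open>c\<close>.\<close>
    show ?thesis
      by (rule threaded_if_links[OF V xy, of "{u, v}" "{c, p, e}" "{u, c}" "{v, p}"])
        (use c p uv w e r_ge N in \<open>auto simp: link_def card_insert_if\<close>)
  next
    case False
    \<comment> \<open>Without such an \<open>e\<close>, \<open>p\<close> is the only point of
      \<open>w\<close> outside \<open>y\<close>. This forces \<open>x\<close> and \<open>y\<close>
      to differ in one exchange, and \<open>w\<close> to consist of \<open>p\<close>,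
      \<open>q\<close> and at least one point \<open>k\<close> of
      \<open>x \<inter> y\<close>.\<close>
    then have out: "(N - (x \<union> y)) \<inter> w = {}" and "x - y = {p}"
      using p w V_D(1)[OF V(1)] by auto
    have "card (x - y) = card x - card (x \<inter> y)" "card (y - x) = card y - card (x \<inter> y)"
      using V by (simp_all add: card_Diff_subset_Int V_D Int_commute)
    moreover have "card (x \<inter> y) \<le> card x"
      using V by (intro card_mono) (auto simp: V_D)
    ultimately have *: "card (x \<inter> y) + 1 = r" "card (y - x) = 1"
      using \<open>x - y = {p}\<close> V_D(2)[OF V(1)] V_D(2)[OF V(2)] r_ge by auto
    then obtain q' where "y - x = {q'}" by (auto simp: card_1_singleton_iff)
    then have "y - x = {q}" using q by (metis singletonD)
    have "x \<inter> y \<inter> w \<noteq> {}"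
    proof
      assume "x \<inter> y \<inter> w = {}"
      moreover have "w \<subseteq> (x \<inter> y \<inter> w) \<union> (x - y) \<union> (y - x) \<union> ((N - (x \<union> y)) \<inter> w)"
        using V_D(1)[OF V(3)] by blast
      ultimately have "w \<subseteq> {p, q}"
        using out \<open>x - y = {p}\<close> \<open>y - x = {q}\<close> by (simp add: insert_commute)
      then have "card w \<le> card {p, q}" by (intro card_mono) auto
      also have "\<dots> \<le> 2" by (simp add: card_insert_if)
      finally show False using V_D(2)[OF V(3)] r_ge by simp
    qed
    then obtain k where k: "k \<in> x \<inter> y" "k \<in> w" by blast
    have "3 \<le> card (N - (x \<union> y))" using card_out * r_ge by simp
    then obtain T where "T \<subseteq> N - (x \<union> y)" "card T = 3"
      by (meson obtain_subset_with_card_n)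
    then obtain d u v where duv: "d \<in> N - (x \<union> y)" "u \<in> N - (x \<union> y)" "v \<in> N - (x \<union> y)"
      "d \<noteq> u" "d \<noteq> v" "u \<noteq> v"
      by (auto simp: card_3_iff)
    with out have "d \<notin> w" "u \<notin> w" "v \<notin> w" by auto
    moreover have "k \<in> N" using k V by (auto dest: V_D)
    ultimately show ?thesis
      \<comment> \<open>All of \<open>d\<close>, \<open>u\<close>, \<open>v\<close> lie outside
        \<open>x\<close>, \<open>y\<close> and \<open>w\<close>. \<open>x\<close> misses both
        \<open>u\<close> and \<open>q\<close> of \<open>{u, k, q}\<close>, \<open>y\<close> misses
        both \<open>v\<close> and \<open>p\<close> of \<open>{v, k, p}\<close>, and the common point
        \<open>k\<close> rules out avoiding these blocks.\<close>
      by (intro threaded_if_links[OF V xy, of "{d, u}" "{v, k, p}" "{d, v}" "{u, k, q}"])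
        (use duv p q k w r_ge N in \<open>auto simp: link_def card_insert_if\<close>)
  qed
qed

lemma threaded:
  assumes V: "x \<in> V" "y \<in> V" "w \<in> V" and xy: "x \<noteq> y" "\<not> adj x y" and w: "w \<noteq> x" "w \<noteq> y"
  shows "threaded x w y"
proof -
  let ?O = "N - (x \<union> y)"
  have "x \<inter> y \<noteq> {}" using xy V by (auto simp: adj_def)
  then have pos: "card (x \<inter> y) > 0" using V by (auto simp: V_D card_gt_0_iff)
  have "card (x \<union> y) + card (x \<inter> y) = 2 * r"
    using card_Un_Int[of x y] V by (simp add: V_D)
  moreover have "card ?O = card N - card (x \<union> y)"
    using V by (intro card_Diff_subset) (auto simp: V_D dest: V_D(1))
  ultimately have card_out: "card ?O = card (x \<inter> y) + 1"
    by (simp add: card_N)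
  then have "?O \<noteq> {}" by force
  have nx: "\<not> x \<subseteq> w" and ny: "\<not> y \<subseteq> w" using V_eqI V w by blast+
  have no_compl: "\<not> N - A \<subseteq> w" if "A \<in> V" for A
    using card_mono[of w "N - A"] card_compl[OF that] V_D[OF V(3)] by auto
  note out = no_compl[OF V(1)] no_compl[OF V(2)]
  show ?thesis
  proof (cases "x \<inter> y \<subseteq> w \<and> ?O \<subseteq> w")
    case True
    with V xy nx ny card_out pos show ?thesis by (intro threaded_equal_opposite) auto
  next
    case I: False
    show ?thesis
    proof (cases "x - y \<subseteq> w \<and> y - x \<subseteq> w")
      case True
      with V xy nx card_out show ?thesis by (intro threaded_sym_diff) auto
    next
      case II: False
      have ne: "x - y \<noteq> {}" "y - x \<noteq> {}" using V_eqI V xy by blast+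
      have "w \<noteq> {}" using V_D(2)[OF V(3)] r_ge by auto
      then have meets: "x \<inter> y \<inter> w \<noteq> {} \<or> (x - y) \<inter> w \<noteq> {} \<or> (y - x) \<inter> w \<noteq> {} \<or> ?O \<inter> w \<noteq> {}"
        using V_D(1)[OF V(3)] by blast
      txt \<open>At most one region lies inside \<open>w\<close>; take the element of \<open>w\<close> from it if there is one.\<close>
      have "\<exists>a\<in>x \<inter> y. \<exists>b\<in>x - y. \<exists>c\<in>y - x. \<exists>d\<in>?O.
        a \<in> w \<and> b \<notin> w \<and> c \<notin> w \<and> d \<notin> w \<or> a \<notin> w \<and> b \<in> w \<and> c \<notin> w \<and> d \<notin> w \<or>
        a \<notin> w \<and> b \<notin> w \<and> c \<in> w \<and> d \<notin> w \<or> a \<notin> w \<and> b \<notin> w \<and> c \<notin> w \<and> d \<in> w"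
      proof -
        \<comment> \<open>\<open>x\<close>, \<open>y\<close> and their complements are each the
          union of two regions, and none of the four fits inside \<open>w\<close>. The two remaining
          pairs of regions are those of the previous cases.\<close>
        have full: "\<not> (x \<inter> y \<subseteq> w \<and> x - y \<subseteq> w)" "\<not> (x \<inter> y \<subseteq> w \<and> y - x \<subseteq> w)"
          "\<not> (x - y \<subseteq> w \<and> ?O \<subseteq> w)" "\<not> (y - x \<subseteq> w \<and> ?O \<subseteq> w)"
          using nx ny out by blast+
        consider "x \<inter> y \<subseteq> w" | "x - y \<subseteq> w" | "y - x \<subseteq> w" | "?O \<subseteq> w"
          | "\<not> x \<inter> y \<subseteq> w" "\<not> x - y \<subseteq> w" "\<not> y - x \<subseteq> w" "\<not> ?O \<subseteq> w" by blast
        then show ?thesis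
        proof cases
          case 1
          then have "\<not> x - y \<subseteq> w" "\<not> y - x \<subseteq> w" "\<not> ?O \<subseteq> w" using full I by blast+
          with 1 \<open>x \<inter> y \<noteq> {}\<close> show ?thesis by blast
        next
          case 2
          then have "\<not> x \<inter> y \<subseteq> w" "\<not> y - x \<subseteq> w" "\<not> ?O \<subseteq> w" using full II by blast+
          with 2 ne show ?thesis by blast
        next
          case 3
          then have "\<not> x \<inter> y \<subseteq> w" "\<not> x - y \<subseteq> w" "\<not> ?O \<subseteq> w" using full II by blast+
          with 3 ne show ?thesis by blast
        next
          case 4
          then have "\<not> x \<inter> y \<subseteq> w" "\<not> x - y \<subseteq> w" "\<not> y - x \<subseteq> w" using full I by blast+
          with 4 \<open>?O \<noteq> {}\<close> show ?thesis by blast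
        next
          case 5
          with meets show ?thesis by blast
        qed
      qed
      then show ?thesis
        by (elim bexE) (rule threaded_transversal[OF V xy])
    qed
  qed
qed

end

section \<open>From threaded vertices to monophonic sets of the Kneser graph\<close>

theorem theorem2p6:
  fixes r :: nat
  assumes "r \<ge> 3"
  shows "monophonic_number (with_proj (kneser_graph (2 * r + 1) r)) = 2 \<and>
    (\<forall>x \<in> pverts (kneser_graph (2 * r + 1) r). \<forall>y \<in> pverts (kneser_graph (2 * r + 1) r).
       x \<noteq> y \<longrightarrow> (x, y) \<notin> parcs (kneser_graph (2 * r + 1) r) \<longrightarrow>
       monophonic_set (with_proj (kneser_graph (2 * r + 1) r)) {x, y})"
proof -
  interpret odd_graph r using assms by unfold_locales
  define G where "G = kneser_graph (2 * r + 1) r"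
  interpret pair_graph G
    unfolding G_def using assms by (intro pair_graph_kneser_graph) simp
  have V: "pverts G = V" and E: "(A, B) \<in> parcs G \<longleftrightarrow> adj A B" for A B
    by (auto simp: G_def kneser_graph_def V_def N_def adj_def)
  \<comment> \<open>The first two vertices share the point 2 and form a concrete non-adjacent pair.
    With the third they ensure that any pair \<open>x\<close>, \<open>y\<close> leaves another
    vertex \<open>w\<close>.\<close>
  have x0: "{1..r} \<in> V" and y0: "{2..r + 1} \<in> V" and w0: "{3..r + 2} \<in> V"
    using assms by (auto simp: V_def N_def)
  have "1 \<in> {1..r}" "1 \<notin> {2..r + 1}" "2 \<in> {2..r + 1}" "2 \<notin> {3..r + 2}" "1 \<notin> {3..r + 2}" "2 \<in> {1..r}"
    using assms by auto
  then have ne0: "{1..r} \<noteq> {2..r + 1}" "{1..r} \<noteq> {3..r + 2}" "{2..r + 1} \<noteq> {3..r + 2}"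
    and nadj0: "\<not> adj {1..r} {2..r + 1}"
    unfolding adj_def by blast+
  have mono: "monophonic_set (with_proj G) {x, y}"
    if xy: "x \<in> V" "y \<in> V" "x \<noteq> y" "\<not> adj x y" for x y
  proof -
    \<comment> \<open>A path through some third \<open>w\<close> also places its own ends
      \<open>x\<close> and \<open>y\<close> in the interval.\<close>
    have interval: "A \<in> monophonic_interval (with_proj G) x y"
      if "threaded x w y" "A \<in> {x, y, w}" for A w
    proof -
      obtain p where p: "chordless adj p" "p \<noteq> []" "hd p = x" "last p = y" "w \<in> set p" "set p \<subseteq> V"
        using \<open>threaded x w y\<close> by (auto simp: threaded_def)
      then have "A \<in> set p" using that(2) by auto
      with p show ?thesis
        using chordless_monophonic_interval[of p A, unfolded V E] by simp
    qed
    have "\<exists>w\<in>V. w \<noteq> x \<and> w \<noteq> y" using x0 y0 w0 ne0 by metis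
    then have "A \<in> monophonic_interval (with_proj G) x y" if "A \<in> V" for A
      using interval threaded[OF xy(1,2) _ xy(3,4)] that by (metis insertCI)
    with xy show ?thesis by (auto simp: monophonic_set_def V)
  qed
  \<comment> \<open>With at most one element in \<open>S\<close>, every interval involved runs from
    a vertex to itself. A path with equal ends and distinct vertices is a single vertex, so
    \<open>S\<close> would contain all of \<open>V\<close>.\<close>
  have "2 \<le> card S" if S: "finite S" "monophonic_set (with_proj G) S" for S
  proof (rule ccontr)
    assume "\<not> 2 \<le> card S"
    then have S1: "x = y" if "x \<in> S" "y \<in> S" for x y
      using that S(1) card_le_Suc0_iff_eq[of S] by simp
    have S_eq: "A \<in> S" if A: "A \<in> V" for A
    proof -
      obtain x y where xy: "x \<in> S" "y \<in> S" "A \<in> monophonic_interval (with_proj G) x y"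
        using S(2) A unfolding monophonic_set_def by (auto simp: V)
      then obtain p where p: "distinct p" "p \<noteq> []" "hd p = x" "last p = x" "A \<in> set p"
        using S1[OF xy(1,2)]
        by (auto simp: monophonic_interval_def induced_path_def vpath_def vwalk_def)
      then have "p = [x]"
        by (cases p) (auto split: if_splits)
      with p xy show ?thesis by simp
    qed
    show False using S1[OF S_eq[OF x0] S_eq[OF y0]] ne0 by simp
  qed
  moreover have "card {{1..r}, {2..r + 1}} = 2"
    using ne0 by simp
  then have "\<exists>S. finite S \<and> monophonic_set (with_proj G) S \<and> card S = 2"
    using mono[OF x0 y0 ne0(1) nadj0] by (intro exI[of _ "{{1..r}, {2..r + 1}}"]) auto
  ultimately have "monophonic_number (with_proj G) = 2"
    unfolding monophonic_number_def by (intro Least_equality) auto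
  with mono show ?thesis
    unfolding G_def[symmetric] by (simp add: V E)
qed

end
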